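(* Let $\phi = \frac{1+\sqrt{5}}{2}$ denote the golden ratio and let $\Gamma$ denote the Gamma function. Then \[ \phi = \frac{2^{2/5}\, \sqrt{5}\; \Gamma\!\left(\frac{1}{5}\right)^4}{\Gamma\!\left(\frac{1}{10}\right)^2\, \Gamma\!\left(\frac{3}{10}\right)^2}. \]
   Context: $\Gamma$ is the (real) Euler Gamma function, $\Gamma(x)=\int_0^\infty t^{x-1}e^{-t}\,dt$ for real $x>0$; $2^{2/5}$ is the positive real power. *)

theory Defs
  imports "HOL-Analysis.Analysis"
begin

definition golden_ratio :: real where
  "golden_ratio = (1 + sqrt 5) / 2"

end

theory Submission
  imports Defs
begin

text \<open>
  Duplication at \<open>1/10\<close> and \<open>3/10\<close> together with reflection at \<open>1/5\<close> eliminates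
  \<open>\<Gamma>(3/5)\<close> and \<open>\<Gamma>(4/5)\<close> and gives
  \<open>\<Gamma>(1/10) \<Gamma>(3/10) = 2\<^sup>6\<^sup>/\<^sup>5 \<Gamma>(1/5)\<^sup>2 sin (\<pi>/5)\<close>.
  The quotient is therefore \<open>\<surd>5 / (4 sin\<^sup>2 (\<pi>/5))\<close>.
\<close>

text \<open>Restricts the complex duplication formula to the positive axis, where \<open>x\<close>
  and \<open>x + 1/2\<close> avoid the poles.\<close>

lemma Gamma_legendre_duplication_real:
  fixes x :: real
  assumes "x > 0"
  shows "Gamma x * Gamma (x + 1/2) = 2 powr (1 - 2 * x) * sqrt pi * Gamma (2 * x)"
proof -
  have "complex_of_real x \<notin> \<int>\<^sub>\<le>\<^sub>0" "complex_of_real (x + 1/2) \<notin> \<int>\<^sub>\<le>\<^sub>0"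
    using assms by (auto simp del: of_real_add simp: of_real_in_nonpos_Ints_iff elim!: nonpos_Ints_cases)
  then have "complex_of_real (Gamma x * Gamma (x + 1/2)) =
      of_real (exp ((1 - 2 * x) * ln 2) * sqrt pi * Gamma (2 * x))"
    using Gamma_legendre_duplication[of "of_real x"]
    by (simp flip: exp_of_real Gamma_complex_of_real)
  then show ?thesis
    by (simp only: of_real_eq_iff powr_def) simp
qed

text \<open>At integers one Gamma argument is a pole, where Gamma is 0 by convention, and division
  by zero gives 0 on the right.\<close>

lemma Gamma_reflection_real:
  fixes x :: real
  shows "Gamma x * Gamma (1 - x) = pi / sin (pi * x)"
proof -
  have "complex_of_real (Gamma x * Gamma (1 - x)) = of_real (pi / sin (pi * x))"
    using Gamma_reflection_complex[of "of_real x"]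
    by (simp flip: sin_of_real Gamma_complex_of_real)
  then show ?thesis
    by (simp only: of_real_eq_iff)
qed

text \<open>Since 3 pi/5 and 2 pi/5 add up to pi, the multiple-angle formulas yield a cubic for the
  cosine.\<close>

lemma cos_pi_fifth: "cos (pi / 5) = (1 + sqrt 5) / 4"
proof -
  define c where "c = cos (pi / 5)"
  have "c > 0"
    unfolding c_def by (rule cos_gt_zero) auto
  have "cos (3 * (pi / 5)) = - cos (2 * (pi / 5))"
    using cos_pi_minus[of "2 * (pi / 5)"] by (simp add: field_simps)
  then have "4 * c ^ 3 - 3 * c = - (2 * c\<^sup>2 - 1)"
    using cos_treble_cos[of "pi / 5"] cos_double_cos[of "pi / 5"] by (simp add: c_def)
  \<comment> \<open>Four times the cubic, with the root -1 split off and the square completed in the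
    other factor.\<close>
  then have "(c + 1) * ((4 * c - 1)\<^sup>2 - 5) = 0"
    by algebra
  with \<open>c > 0\<close> have "(4 * c - 1)\<^sup>2 = 5"
    by simp
  then have "\<bar>4 * c - 1\<bar> = sqrt 5"
    by (metis real_sqrt_abs)
  moreover have "sqrt 5 > 1"
    by simp
  ultimately have "4 * c - 1 = sqrt 5"
    using \<open>c > 0\<close> by linarith
  then show ?thesis
    by (simp add: c_def)
qed

lemma sin_pi_fifth_squared: "(sin (pi / 5))\<^sup>2 = (5 - sqrt 5) / 8"
  unfolding sin_squared_eq cos_pi_fifth by (simp add: power2_eq_square field_simps)

lemma Gamma_tenth_mult_three_tenths:
  "Gamma (1/10) * Gamma (3/10) = 2 powr (6/5) * Gamma (1/5 :: real) ^ 2 * sin (pi / 5)"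
proof -
  have pos: "Gamma (3/5 :: real) > 0" "Gamma (4/5 :: real) > 0" "sin (pi / 5) > 0"
    by (auto intro: sin_gt_zero)
  have "Gamma (1/10) * Gamma (3/5) = 2 powr (4/5) * sqrt pi * Gamma (1/5 :: real)"
    using Gamma_legendre_duplication_real[of "1/10"] by simp
  moreover have "Gamma (3/10) * Gamma (4/5) = 2 powr (2/5) * sqrt pi * Gamma (3/5 :: real)"
    using Gamma_legendre_duplication_real[of "3/10"] by simp
  ultimately have "(Gamma (1/10) * Gamma (3/5)) * (Gamma (3/10) * Gamma (4/5)) =
      (2 powr (4/5) * 2 powr (2/5)) * (sqrt pi)\<^sup>2 * Gamma (1/5) * Gamma (3/5 :: real)"
    by (simp add: power2_eq_square)
  also have "2 powr (4/5) * 2 powr (2/5) = (2 powr (6/5) :: real)"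
    by (simp flip: powr_add)
  \<comment> \<open>Trading pi for this product puts \<open>Gamma (4/5)\<close> on the right too, so
    it cancels along with \<open>Gamma (3/5)\<close>.\<close>
  also have "(sqrt pi)\<^sup>2 = Gamma (1/5) * Gamma (4/5) * sin (pi / 5)"
    using Gamma_reflection_real[of "1/5"] pos by (simp add: field_simps)
  finally show ?thesis
    using pos by (simp add: power2_eq_square)
qed

theorem proposition1:
  shows "golden_ratio =
    2 powr (2/5) * sqrt 5 * Gamma (1/5 :: real) ^ 4 /
      (Gamma (1/10 :: real) ^ 2 * Gamma (3/10 :: real) ^ 2)"
proof -
  \<comment> \<open>The exponent 12/5 is split so that the numerator's \<open>2 powr (2/5)\<close>
    cancels.\<close>
  have "(2 powr (6/5))\<^sup>2 = (2 powr (2/5 + 2) :: real)"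
    by (simp add: power2_eq_square flip: powr_add)
  also have "\<dots> = 4 * 2 powr (2/5)"
    by (subst powr_add) simp
  finally have denom: "Gamma (1/10) ^ 2 * Gamma (3/10) ^ 2 =
      4 * 2 powr (2/5) * Gamma (1/5 :: real) ^ 4 * ((5 - sqrt 5) / 8)"
    unfolding power_mult_distrib[symmetric] Gamma_tenth_mult_three_tenths
    by (simp add: power_mult_distrib sin_pi_fifth_squared flip: power_mult)
  \<comment> \<open>What remains of the quotient after cancellation; cleared of denominators, it
    says (1 + sqrt 5)(5 - sqrt 5) = 4 sqrt 5.\<close>
  have "golden_ratio = sqrt 5 * 2 / (5 - sqrt 5)"
  proof -
    have "sqrt 5 < 5"
      by (simp add: real_less_lsqrt)
    then show ?thesis
      by (simp add: golden_ratio_def field_simps)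
  qed
  moreover have "Gamma (1/5 :: real) \<noteq> 0"
    using Gamma_real_pos[of "1/5"] by linarith
  ultimately show ?thesis
    unfolding denom by simp
qed

end
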